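(* Let $G$ be a topological rough group, with topology $\tau$ on its upper approximation $\overline{G}$. If $(\overline{G},\tau)$ is a $T_0$-space, then $G$ (with the topology $\tau_G$ induced by $\tau$) is a $T_1$-space.
   Context: An approximation space $(U,R)$ is a non-empty set $U$ with an equivalence relation $R$; for $X\subset U$ the upper approximation is $\overline{X}=\{x\in U:[x]_R\cap X\neq\emptyset\}$, where $[x]_R$ is the equivalence class of $x$. Let $U$ carry a binary operation, written $xy$. A subset $G\subset U$ is a rough group if: (1) $xy\in\overline{G}$ for all $x,y\in G$; (2) $(xy)z=x(yz)$ for all $x,y,z\in\overline{G}$; (3) there is $e\in\overline{G}$ (the rough identity element) with $ex=xe=x$ for all $x\in\overline{G}$; (4) for every $x\in G$ there is $y\in G$ with $xy=yx=e$ (written $y=x^{-1}$). A topological rough group is a rough group $G$ together with a topology $\tau$ on $\overline{G}$ such that, with $\tau_G$ the subspace topology on $G$, the multiplication $G\times G\to\overline{G}$, $(x,y)\mapsto xy$, is continuous (product topology of $\tau_G$ on $G\times G$, $\tau$ on $\overline{G}$) and the inverse mapping $G\to G$, $x\mapsto x^{-1}$, is continuous for $\tau_G$. *)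

theory Defs
  imports "HOL-Analysis.Analysis"
begin

locale approximation_space =
  fixes U :: "'a set" and R :: "('a \<times> 'a) set"
  assumes nonempty: "U \<noteq> {}"
    and equiv: "equiv U R"

definition upper_approx :: "'a set \<Rightarrow> ('a \<times> 'a) set \<Rightarrow> 'a set \<Rightarrow> 'a set" where
  "upper_approx U R X = {x \<in> U. R `` {x} \<inter> X \<noteq> {}}"

locale rough_group = approximation_space U R
  for U :: "'a set" and R :: "('a \<times> 'a) set" +
  fixes mult :: "'a \<Rightarrow> 'a \<Rightarrow> 'a" (infixl "\<cdot>" 70)
    and G :: "'a set"
  assumes mult_in_U: "\<lbrakk>x \<in> U; y \<in> U\<rbrakk> \<Longrightarrow> x \<cdot> y \<in> U"
    and subset_U: "G \<subseteq> U"
    and mult_in_upper: "\<lbrakk>x \<in> G; y \<in> G\<rbrakk> \<Longrightarrow> x \<cdot> y \<in> upper_approx U R G"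
    and mult_assoc: "\<lbrakk>x \<in> upper_approx U R G; y \<in> upper_approx U R G; z \<in> upper_approx U R G\<rbrakk>
          \<Longrightarrow> (x \<cdot> y) \<cdot> z = x \<cdot> (y \<cdot> z)"
    and identity_inverse_ex: "\<exists>e \<in> upper_approx U R G.
          (\<forall>x \<in> upper_approx U R G. e \<cdot> x = x \<and> x \<cdot> e = x) \<and>
          (\<forall>x \<in> G. \<exists>y \<in> G. x \<cdot> y = e \<and> y \<cdot> x = e)"
begin

text \<open>
  The descriptions below are well defined: the rough identity is unique, and so is the inverse
  in \<open>G\<close> of each element of \<open>G\<close> (see \<open>rough_identity_unique\<close> and \<open>rough_inv_unique\<close>).
\<close>

definition rough_identity :: 'a where
  "rough_identity = (THE e. e \<in> upper_approx U R G \<and>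
     (\<forall>x \<in> upper_approx U R G. e \<cdot> x = x \<and> x \<cdot> e = x))"

definition rough_inv :: "'a \<Rightarrow> 'a" where
  "rough_inv x = (THE y. y \<in> G \<and> x \<cdot> y = rough_identity \<and> y \<cdot> x = rough_identity)"

lemma subset_upper: "G \<subseteq> upper_approx U R G"
  using subset_U equiv equiv_class_self unfolding upper_approx_def by fastforce

lemma rough_identity_unique:
  assumes "e \<in> upper_approx U R G"
    and "\<forall>x \<in> upper_approx U R G. e \<cdot> x = x \<and> x \<cdot> e = x"
  shows "rough_identity = e"
  unfolding rough_identity_def
proof (rule the_equality)
  fix d assume "d \<in> upper_approx U R G \<and>
    (\<forall>x \<in> upper_approx U R G. d \<cdot> x = x \<and> x \<cdot> d = x)"
  then show "d = e"
    using assms by metis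
qed (use assms in auto)

lemma rough_identity:
  shows rough_identity_in_upper: "rough_identity \<in> upper_approx U R G"
    and rough_identity_left: "x \<in> upper_approx U R G \<Longrightarrow> rough_identity \<cdot> x = x"
    and rough_identity_right: "x \<in> upper_approx U R G \<Longrightarrow> x \<cdot> rough_identity = x"
    and rough_inverse_ex:
      "x \<in> G \<Longrightarrow> \<exists>y \<in> G. x \<cdot> y = rough_identity \<and> y \<cdot> x = rough_identity"
  using identity_inverse_ex rough_identity_unique by metis+

lemma rough_inv_unique:
  assumes "x \<in> G" "y \<in> G" "x \<cdot> y = rough_identity" "y \<cdot> x = rough_identity"
  shows "rough_inv x = y"
  unfolding rough_inv_def
proof (rule the_equality)
  fix z assume z: "z \<in> G \<and> x \<cdot> z = rough_identity \<and> z \<cdot> x = rough_identity"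
  have up: "x \<in> upper_approx U R G" "y \<in> upper_approx U R G" "z \<in> upper_approx U R G"
    using assms z subset_upper by auto
  have "z = z \<cdot> (x \<cdot> y)"
    using rough_identity_right up assms by simp
  also have "\<dots> = (z \<cdot> x) \<cdot> y"
    using mult_assoc up by simp
  also have "\<dots> = y"
    using z up rough_identity_left by simp
  finally show "z = y" .
qed (use assms in auto)

lemma rough_inv:
  assumes "x \<in> G"
  shows "rough_inv x \<in> G" "x \<cdot> rough_inv x = rough_identity" "rough_inv x \<cdot> x = rough_identity"
  using rough_inverse_ex[OF assms] rough_inv_unique[OF assms] by auto

end

locale topological_rough_group = rough_group U R mult G
  for U :: "'a set" and R :: "('a \<times> 'a) set"
    and mult :: "'a \<Rightarrow> 'a \<Rightarrow> 'a" (infixl "\<cdot>" 70) and G :: "'a set" +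
  fixes T :: "'a topology"
  assumes topspace_eq: "topspace T = upper_approx U R G"
    and continuous_mult:
      "continuous_map (prod_topology (subtopology T G) (subtopology T G)) T (\<lambda>(x, y). x \<cdot> y)"
    and continuous_inv:
      "continuous_map (subtopology T G) (subtopology T G) rough_inv"

end

theory Submission
  imports Defs
begin

text \<open>
  For distinct \<open>x, y \<in> G\<close> the points \<open>e\<close> and \<open>x\<inverse>y\<close> of the upper approximation are distinct, so some
  open \<open>V\<close> contains exactly one of them. The continuous maps \<open>z \<mapsto> x\<inverse>z\<close> and \<open>z \<mapsto> z\<inverse>y\<close> from \<open>G\<close> send
  \<open>(x, y)\<close> to \<open>(e, x\<inverse>y)\<close> and to \<open>(x\<inverse>y, e)\<close> respectively, so the preimages of \<open>V\<close> under them separate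
  \<open>x\<close> and \<open>y\<close> in both directions. Only \<open>x\<inverse>\<close>, \<open>y\<close> and \<open>z\<close> are ever multiplied, so \<open>e\<close> need not lie in \<open>G\<close>.
\<close>

context rough_group
begin

text \<open>Multiplying by \<open>x\<close> on the left cancels \<open>rough_inv x\<close>;
  associativity applies as all three factors lie in \<open>G\<close>, hence in the upper
  approximation.\<close>

lemma rough_inv_mult_eq_identity_iff:
  assumes "x \<in> G" "y \<in> G"
  shows "rough_inv x \<cdot> y = rough_identity \<longleftrightarrow> x = y"
proof
  assume eq: "rough_inv x \<cdot> y = rough_identity"
  have up: "x \<in> upper_approx U R G" "y \<in> upper_approx U R G" "rough_inv x \<in> upper_approx U R G"
    using assms rough_inv(1) subset_upper by auto
  have "y = (x \<cdot> rough_inv x) \<cdot> y"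
    using up assms rough_inv(2) rough_identity_left by simp
  also have "\<dots> = x \<cdot> rough_identity"
    using mult_assoc up eq by simp
  finally show "x = y"
    using up rough_identity_right by simp
qed (use assms rough_inv(3) in auto)

end

context topological_rough_group
begin

lemma topspace_subtopology_G: "topspace (subtopology T G) = G"
  using subset_upper topspace_eq by auto

text \<open>With one factor constant, joint continuity becomes continuity in one variable.\<close>

lemma continuous_map_mult:
  assumes "continuous_map X (subtopology T G) f" "continuous_map X (subtopology T G) g"
  shows "continuous_map X T (\<lambda>z. f z \<cdot> g z)"
  using continuous_map_compose[OF continuous_map_pairedI[OF assms] continuous_mult]
  by (simp add: o_def)

lemma t1_space_if_t0_space:
  assumes "t0_space T"
  shows "t1_space (subtopology T G)"
  unfolding t1_space_def topspace_subtopology_G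
proof (intro ballI impI)
  fix x y assume x: "x \<in> G" and y: "y \<in> G" and "x \<noteq> y"
  let ?S = "subtopology T G"
  let ?p = "rough_inv x \<cdot> y"
  let ?f = "\<lambda>z. rough_inv x \<cdot> z" and ?g = "\<lambda>z. rough_inv z \<cdot> y"
  have "?p \<noteq> rough_identity"
    using rough_inv_mult_eq_identity_iff x y \<open>x \<noteq> y\<close> by blast
  moreover have "?p \<in> topspace T" "rough_identity \<in> topspace T"
    using mult_in_upper rough_inv(1) x y rough_identity_in_upper topspace_eq by auto
  ultimately obtain V where V: "openin T V" "rough_identity \<in> V \<longleftrightarrow> ?p \<notin> V"
    using assms unfolding t0_space_def by metis
  have f: "continuous_map ?S T ?f"
    using rough_inv(1)[OF x] topspace_subtopology_G by (intro continuous_map_mult) auto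
  have g: "continuous_map ?S T ?g"
    using continuous_inv y topspace_subtopology_G by (intro continuous_map_mult) auto
  have op: "openin ?S {z \<in> G. ?f z \<in> V}" "openin ?S {z \<in> G. ?g z \<in> V}"
    using openin_continuous_map_preimage[OF f V(1)] openin_continuous_map_preimage[OF g V(1)]
    unfolding topspace_subtopology_G by auto
  have ends: "?f x = rough_identity" "?g y = rough_identity"
    using rough_inv(3) x y by auto
  show "\<exists>W. openin ?S W \<and> x \<in> W \<and> y \<notin> W"
  \<comment> \<open>The map is chosen to send \<open>x\<close> into \<open>V\<close>:
    \<open>?f x\<close> is the identity, \<open>?g x\<close> is \<open>?p\<close>, and
    \<open>y\<close> goes to the other point.\<close>
  proof (cases "rough_identity \<in> V")
    case True
    then have "x \<in> {z \<in> G. ?f z \<in> V}" "y \<notin> {z \<in> G. ?f z \<in> V}"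
      using V(2) ends x by auto
    then show ?thesis using op(1) by blast
  next
    case False
    then have "x \<in> {z \<in> G. ?g z \<in> V}" "y \<notin> {z \<in> G. ?g z \<in> V}"
      using V(2) ends x by auto
    then show ?thesis using op(2) by blast
  qed
qed

end

theorem theorem3p3:
  fixes U :: "'a set" and R :: "('a \<times> 'a) set" and mult :: "'a \<Rightarrow> 'a \<Rightarrow> 'a"
    and G :: "'a set" and T :: "'a topology"
  assumes "topological_rough_group U R mult G T"
    and "t0_space T"
  shows "t1_space (subtopology T G)"
  using assms by (rule topological_rough_group.t1_space_if_t0_space)

end
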